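(* The SVD-based EM-0.5 CKF (Algorithm 2b) is algebraically equivalent to the conventional EM-0.5 CKF (Algorithm 2a), both algorithms being written out in the context. Explicitly, in exact real arithmetic: let both algorithms be given the same data $f,h,\tilde G,Q,\bar x_0,\Pi_0,(R_k)_{k=1}^K,\Delta,M$ and the same measurements $z_1,\dots,z_K$. Take any run of Algorithm 2b. Then there is a run of Algorithm 2a in which, at each step where Algorithm 2a performs an SVD of a covariance matrix, the chosen SVD factors are the factors of the corresponding covariance carried by Algorithm 2b at that point (in particular, these factors are legitimate SVD factors of that matrix). For these runs, for all $k=1,\dots,K$ and $m=0,\dots,M$: (i) the estimates $\hat x^{(m)}_{k-1|k-1}$, $\hat x_{k|k-1}$, $\hat z_{k|k-1}$, $\hat x_{k|k}$, the cross-covariances $P_{xz,k}$ and the gains $\mathbb K_k$ computed by the two algorithms coincide; (ii) the covariance matrices computed by Algorithm 2a are represented by the SVD factors computed by Algorithm 2b: $$P^{(m)}_{k-1|k-1}=Q^{(m)}_{P_{k-1|k-1}}D^{(m)}_{P_{k-1|k-1}}\bigl[Q^{(m)}_{P_{k-1|k-1}}\bigr]^{\top},\qquad P_{k|k-1}=Q_{P_{k|k-1}}D_{P_{k|k-1}}Q_{P_{k|k-1}}^{\top},$$ $$R_{e,k}=Q_{R_{e,k}}D_{R_{e,k}}Q_{R_{e,k}}^{\top},\qquad P_{k|k}=Q_{P_{k|k}}D_{P_{k|k}}Q_{P_{k|k}}^{\top},$$ where the matrices $Q_{\cdot}$ are orthogonal and the matrices $D_{\cdot}$ are diagonal with nonnegative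 entries.
   Context: **Model.** The continuous-discrete stochastic system is $dx(t)=f(t,x(t))\,dt+\tilde G\,d\beta(t)$, $t>0$, and $z_k=h(k,x(t_k))+v_k$, $k=1,2,\dots$, with $x(t)\in\mathbb R^n$, $z_k\in\mathbb R^m$ (this $m$ is the measurement dimension; elsewhere $m$ is a loop index), $f:\mathbb R\times\mathbb R^n\to\mathbb R^n$, $h:\mathbb R\times\mathbb R^n\to\mathbb R^m$, $\tilde G\in\mathbb R^{n\times n}$ constant. $\beta$ is an $n$-dimensional Brownian motion whose increment has covariance $Q\,dt>0$; $v_k$ is zero-mean white Gaussian noise with covariance $R_k>0$; $x(t_0)$ is Gaussian with mean $\bar x_0$ and covariance $\Pi_0>0$; the noises and $x(t_0)$ are independent. The sampling period $\Delta=t_k-t_{k-1}$ is constant; $M\ge 1$ is an integer, $\delta=\Delta/M$, $t_{k-1}^{(m)}=t_{k-1}+m\delta$. **Notation.** $e_i$ is the $i$-th unit vector of $\mathbb R^n$; $\xi_i=\sqrt n\,e_i$, $\xi_{n+i}=-\sqrt n\,e_i$ ($i=1,\dots,n$); $\mathbf 1_{2n}$ is the column of $2n$ ones; $\otimes$ is the Kronecker product. An SVD of a symmetric positive semidefinite matrix $P$ is a factorization $P=Q_PD_PQ_P^\top$ with $Q_P$ orthogonal and $D_P$ diagonal with nonnegative, nonincreasing entries; $D_P^{1/2}$ is the entrywise square root of the diagonal. $R_k=Q_{R_k}D_{R_k}Q_{R_k}^\top$ and $Q=Q_QD_QQ_Q^\top$ are SVDs of $R_k$ and of the process covariance $Q$.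 For a real $p\times q$ matrix $A$ with $p\le q$, $[W,S]\leftarrow \mathrm{svd}(A,\mathrm{econ})$ means: take a singular value decomposition $A=W[S\ \ 0]V^\top$ with $W\in\mathbb R^{p\times p}$, $V\in\mathbb R^{q\times q}$ orthogonal and $S\in\mathbb R^{p\times p}$ diagonal with nonnegative, nonincreasing entries, and return $W$ and $S$. SVD factors need not be unique; a run of an algorithm involves a choice of them. **Algorithm 2a (conventional EM-0.5 CKF).** Initialization: $\hat x_{0|0}=\bar x_0$, $P_{0|0}=\Pi_0$. For $k=1,\dots,K$: *Time update.* Set $\hat x^{(0)}_{k-1|k-1}=\hat x_{k-1|k-1}$, $P^{(0)}_{k-1|k-1}=P_{k-1|k-1}$. For $m=0,\dots,M-1$: - take an SVD $P^{(m)}_{k-1|k-1}=Q^{(m)}_{P_{k-1|k-1}}D^{(m)}_{P_{k-1|k-1}}[Q^{(m)}_{P_{k-1|k-1}}]^\top$ and set $S^{(m)}_{P_{k-1|k-1}}=Q^{(m)}_{P_{k-1|k-1}}[D^{(m)}_{P_{k-1|k-1}}]^{1/2}$; - for $i=1,\dots,2n$ set $\mathcal X^{(m)}_{i,k-1|k-1}=S^{(m)}_{P_{k-1|k-1}}\xi_i+\hat x^{(m)}_{k-1|k-1}$ and $\mathcal X^{(m+1)}_{i,k-1|k-1}=\mathcal X^{(m)}_{i,k-1|k-1}+\delta f(t^{(m)}_{k-1},\mathcal X^{(m)}_{i,k-1|k-1})$; - $\mathcal X^{(m+1)}_{k-1|k-1}=[\mathcal X^{(m+1)}_{1,k-1|k-1},\dots,\mathcal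 X^{(m+1)}_{2n,k-1|k-1}]$, $\hat x^{(m+1)}_{k-1|k-1}=\frac1{2n}\mathcal X^{(m+1)}_{k-1|k-1}\mathbf 1_{2n}$, $\mathbb X^{(m+1)}_{k-1|k-1}=\frac1{\sqrt{2n}}(\mathcal X^{(m+1)}_{k-1|k-1}-\mathbf 1_{2n}^\top\otimes\hat x^{(m+1)}_{k-1|k-1})$; - $P^{(m+1)}_{k-1|k-1}=\mathbb X^{(m+1)}_{k-1|k-1}[\mathbb X^{(m+1)}_{k-1|k-1}]^\top+\delta\,\tilde GQ\tilde G^\top$. Set $\hat x_{k|k-1}=\hat x^{(M)}_{k-1|k-1}$, $P_{k|k-1}=P^{(M)}_{k-1|k-1}$. *Measurement update.* Take an SVD $P_{k|k-1}=Q_{P_{k|k-1}}D_{P_{k|k-1}}Q_{P_{k|k-1}}^\top$, set $S_{P_{k|k-1}}=Q_{P_{k|k-1}}D^{1/2}_{P_{k|k-1}}$. For $i=1,\dots,2n$: $\mathcal X_{i,k|k-1}=S_{P_{k|k-1}}\xi_i+\hat x_{k|k-1}$, $\mathcal Z_{i,k|k-1}=h(k,\mathcal X_{i,k|k-1})$. Collect $\mathcal X_{k|k-1}=[\mathcal X_{1,k|k-1},\dots,\mathcal X_{2n,k|k-1}]$, $\mathcal Z_{k|k-1}=[\mathcal Z_{1,k|k-1},\dots,\mathcal Z_{2n,k|k-1}]$; $\hat z_{k|k-1}=\frac1{2n}\mathcal Z_{k|k-1}\mathbf 1_{2n}$; $\mathbb X_{k|k-1}=\frac1{\sqrt{2n}}(\mathcal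 X_{k|k-1}-\mathbf 1_{2n}^\top\otimes\hat x_{k|k-1})$; $\mathbb Z_{k|k-1}=\frac1{\sqrt{2n}}(\mathcal Z_{k|k-1}-\mathbf 1_{2n}^\top\otimes\hat z_{k|k-1})$. Then $R_{e,k}=\mathbb Z_{k|k-1}\mathbb Z_{k|k-1}^\top+R_k$, $P_{xz,k}=\mathbb X_{k|k-1}\mathbb Z_{k|k-1}^\top$, $\mathbb K_k=P_{xz,k}R_{e,k}^{-1}$, $\hat x_{k|k}=\hat x_{k|k-1}+\mathbb K_k(z_k-\hat z_{k|k-1})$, $P_{k|k}=P_{k|k-1}-\mathbb K_kR_{e,k}\mathbb K_k^\top$. **Algorithm 2b (SVD-based EM-0.5 CKF).** Initialization: take an SVD $\Pi_0=Q_{\Pi_0}D_{\Pi_0}Q_{\Pi_0}^\top$; set $\hat x_{0|0}=\bar x_0$, $Q_{P_{0|0}}=Q_{\Pi_0}$, $D^{1/2}_{P_{0|0}}=D^{1/2}_{\Pi_0}$. For $k=1,\dots,K$: *Time update.* Set $\hat x^{(0)}_{k-1|k-1}=\hat x_{k-1|k-1}$, $Q^{(0)}_{P_{k-1|k-1}}=Q_{P_{k-1|k-1}}$, $D^{(0),1/2}_{P_{k-1|k-1}}=D^{1/2}_{P_{k-1|k-1}}$. For $m=0,\dots,M-1$: - set $S^{(m)}_{P_{k-1|k-1}}=Q^{(m)}_{P_{k-1|k-1}}D^{(m),1/2}_{P_{k-1|k-1}}$; - compute $\mathcal X^{(m)}_{i,k-1|k-1}$, $\mathcal X^{(m+1)}_{i,k-1|k-1}$,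 $\mathcal X^{(m+1)}_{k-1|k-1}$, $\hat x^{(m+1)}_{k-1|k-1}$, $\mathbb X^{(m+1)}_{k-1|k-1}$ from $S^{(m)}_{P_{k-1|k-1}}$ and $\hat x^{(m)}_{k-1|k-1}$ by the same formulas as in Algorithm 2a; - form $T=\bigl[\mathbb X^{(m+1)}_{k-1|k-1},\ \sqrt\delta\,\tilde GQ_QD_Q^{1/2}\bigr]$ and $[Q^{(m+1)}_{P_{k-1|k-1}},D^{(m+1),1/2}_{P_{k-1|k-1}}]\leftarrow\mathrm{svd}(T,\mathrm{econ})$. Set $\hat x_{k|k-1}=\hat x^{(M)}_{k-1|k-1}$, $Q_{P_{k|k-1}}=Q^{(M)}_{P_{k-1|k-1}}$, $D^{1/2}_{P_{k|k-1}}=D^{(M),1/2}_{P_{k-1|k-1}}$. *Measurement update.* Set $S_{P_{k|k-1}}=Q_{P_{k|k-1}}D^{1/2}_{P_{k|k-1}}$; compute $\mathcal X_{i,k|k-1},\mathcal Z_{i,k|k-1},\mathcal X_{k|k-1},\mathcal Z_{k|k-1},\hat z_{k|k-1},\mathbb X_{k|k-1},\mathbb Z_{k|k-1}$ by the same formulas as in Algorithm 2a. Form $A=[\mathbb Z_{k|k-1},\ Q_{R_k}D_{R_k}^{1/2}]$ and $[Q_{R_{e,k}},D^{1/2}_{R_{e,k}}]\leftarrow\mathrm{svd}(A,\mathrm{econ})$. Compute $P_{xz,k}=\mathbb X_{k|k-1}\mathbb Z_{k|k-1}^\top$, $\mathbb K_k=P_{xz,k}Q_{R_{e,k}}D_{R_{e,k}}^{-1}Q_{R_{e,k}}^\top$,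 $\hat x_{k|k}=\hat x_{k|k-1}+\mathbb K_k(z_k-\hat z_{k|k-1})$. Form $B=[\mathbb X_{k|k-1}-\mathbb K_k\mathbb Z_{k|k-1},\ \mathbb K_kQ_{R_k}D_{R_k}^{1/2}]$ and $[Q_{P_{k|k}},D^{1/2}_{P_{k|k}}]\leftarrow\mathrm{svd}(B,\mathrm{econ})$. Here every $D_{\cdot}$ (or $D^{(m)}_{\cdot}$) in Algorithm 2b denotes the square of the corresponding diagonal matrix $D^{1/2}_{\cdot}$ (or $D^{(m),1/2}_{\cdot}$). *)

theory Defs
  imports Complex_Main "Jordan_Normal_Form.Gauss_Jordan_Elimination"
begin

text \<open>The library's \<^const>\<open>orthogonal_mat\<close> only asks for pairwise orthogonal nonzero
  columns, so orthonormality is stated separately.\<close>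

definition orthonormal_mat :: "nat \<Rightarrow> real mat \<Rightarrow> bool" where
  "orthonormal_mat n A \<longleftrightarrow>
     A \<in> carrier_mat n n \<and> A * transpose_mat A = 1\<^sub>m n \<and> transpose_mat A * A = 1\<^sub>m n"

definition pos_def_mat :: "nat \<Rightarrow> real mat \<Rightarrow> bool" where
  "pos_def_mat n A \<longleftrightarrow>
     A \<in> carrier_mat n n \<and> transpose_mat A = A \<and>
     (\<forall>v\<in>carrier_vec n. v \<noteq> 0\<^sub>v n \<longrightarrow> v \<bullet> (A *\<^sub>v v) > 0)"

definition nonneg_diag_mat :: "nat \<Rightarrow> real mat \<Rightarrow> bool" where
  "nonneg_diag_mat n D \<longleftrightarrow>
     D \<in> carrier_mat n n \<and> diagonal_mat D \<and> (\<forall>i<n. 0 \<le> D $$ (i,i))"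

definition nonincreasing_diag :: "nat \<Rightarrow> real mat \<Rightarrow> bool" where
  "nonincreasing_diag n D \<longleftrightarrow> (\<forall>i<n. \<forall>j<n. i \<le> j \<longrightarrow> D $$ (j,j) \<le> D $$ (i,i))"

definition spectral_factors :: "real mat \<Rightarrow> real mat \<Rightarrow> real mat \<Rightarrow> bool" where
  "spectral_factors P Q D \<longleftrightarrow>
     P = Q * D * transpose_mat Q \<and>
     orthonormal_mat (dim_row P) Q \<and> nonneg_diag_mat (dim_row P) D"

definition is_psd_svd :: "real mat \<Rightarrow> real mat \<Rightarrow> real mat \<Rightarrow> bool" where
  "is_psd_svd P Q D \<longleftrightarrow> spectral_factors P Q D \<and> nonincreasing_diag (dim_row P) D"

text \<open>\<open>hcat A B\<close> is the block row \<open>[A, B]\<close>.\<close>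

definition hcat :: "real mat \<Rightarrow> real mat \<Rightarrow> real mat" where
  "hcat A B = four_block_mat A B (0\<^sub>m 0 (dim_col A)) (0\<^sub>m 0 (dim_col B))"

definition kron :: "real mat \<Rightarrow> real mat \<Rightarrow> real mat" where
  "kron A B = mat (dim_row A * dim_row B) (dim_col A * dim_col B)
     (\<lambda>(i,j). A $$ (i div dim_row B, j div dim_col B) * B $$ (i mod dim_row B, j mod dim_col B))"

text \<open>\<open>W\<close> and \<open>S\<close> are a possible output of the economy-size SVD of a matrix \<open>A\<close> having at
  least as many columns as rows; the right orthogonal factor is discarded.\<close>

definition svd_econ :: "real mat \<Rightarrow> real mat \<Rightarrow> real mat \<Rightarrow> bool" where
  "svd_econ A W S \<longleftrightarrow>
     (let p = dim_row A; q = dim_col A in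
        p \<le> q \<and> orthonormal_mat p W \<and> nonneg_diag_mat p S \<and> nonincreasing_diag p S \<and>
        (\<exists>V. orthonormal_mat q V \<and> A = W * hcat S (0\<^sub>m p (q - p)) * transpose_mat V))"

text \<open>Unspecified for singular matrices.\<close>

definition mat_inv :: "real mat \<Rightarrow> real mat" where
  "mat_inv A = the (mat_inverse A)"

text \<open>Entrywise, hence the square root of a nonnegative diagonal matrix.\<close>

definition diag_sqrt :: "real mat \<Rightarrow> real mat" where
  "diag_sqrt D = map_mat sqrt D"

record ckf_data =
  dim_x :: nat
  dim_z :: nat
  drift :: "real \<Rightarrow> real vec \<Rightarrow> real vec"
  obs :: "real \<Rightarrow> real vec \<Rightarrow> real vec"
  diffusion :: "real mat"
  proc_cov :: "real mat"
  meas_cov :: "nat \<Rightarrow> real mat"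
  init_mean :: "real vec"
  init_cov :: "real mat"
  init_time :: real
  period :: real
  substeps :: nat
  horizon :: nat
  meas :: "nat \<Rightarrow> real vec"

definition valid_ckf_data :: "ckf_data \<Rightarrow> bool" where
  "valid_ckf_data d \<longleftrightarrow>
     (let n = dim_x d; p = dim_z d in
        0 < n \<and> 0 < p \<and>
        (\<forall>t. \<forall>x\<in>carrier_vec n. drift d t x \<in> carrier_vec n) \<and>
        (\<forall>t. \<forall>x\<in>carrier_vec n. obs d t x \<in> carrier_vec p) \<and>
        diffusion d \<in> carrier_mat n n \<and>
        pos_def_mat n (proc_cov d) \<and>
        (\<forall>k\<in>{1..horizon d}. pos_def_mat p (meas_cov d k)) \<and>
        init_mean d \<in> carrier_vec n \<and>
        pos_def_mat n (init_cov d) \<and>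
        0 < period d \<and> 1 \<le> substeps d \<and>
        (\<forall>k\<in>{1..horizon d}. meas d k \<in> carrier_vec p))"

definition substep :: "ckf_data \<Rightarrow> real" where
  "substep d = period d / real (substeps d)"

text \<open>\<open>sub_time d k m\<close> is the time \<open>t_{k-1} + m \<delta>\<close>, where \<open>t_{k-1} = t_0 + (k-1) \<Delta>\<close>.\<close>

definition sub_time :: "ckf_data \<Rightarrow> nat \<Rightarrow> nat \<Rightarrow> real" where
  "sub_time d k m = init_time d + real (k - 1) * period d + real m * substep d"

text \<open>Cubature points are numbered \<open>0, \<dots>, 2n - 1\<close>.\<close>

definition cubature_vec :: "nat \<Rightarrow> nat \<Rightarrow> real vec" where
  "cubature_vec n i =
     (if i < n then sqrt (real n) \<cdot>\<^sub>v unit_vec n i else (- sqrt (real n)) \<cdot>\<^sub>v unit_vec n (i - n))"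

definition cubature_nodes :: "nat \<Rightarrow> real mat \<Rightarrow> real vec \<Rightarrow> real mat" where
  "cubature_nodes n S x =
     mat_of_cols n (map (\<lambda>i. S *\<^sub>v cubature_vec n i + x) [0..<2*n])"

definition propagated_nodes :: "ckf_data \<Rightarrow> nat \<Rightarrow> nat \<Rightarrow> real mat \<Rightarrow> real mat" where
  "propagated_nodes d k m X =
     mat_of_cols (dim_x d)
       (map (\<lambda>c. c + substep d \<cdot>\<^sub>v drift d (sub_time d k m) c) (cols X))"

definition observed_nodes :: "ckf_data \<Rightarrow> nat \<Rightarrow> real mat \<Rightarrow> real mat" where
  "observed_nodes d k X = mat_of_cols (dim_z d) (map (obs d (real k)) (cols X))"

definition node_mean :: "nat \<Rightarrow> real mat \<Rightarrow> real vec" where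
  "node_mean n X = (1 / (2 * real n)) \<cdot>\<^sub>v (X *\<^sub>v vec (2*n) (\<lambda>_. 1))"

definition scaled_dev :: "nat \<Rightarrow> real mat \<Rightarrow> real vec \<Rightarrow> real mat" where
  "scaled_dev n X c =
     (1 / sqrt (2 * real n)) \<cdot>\<^sub>m
       (X - kron (mat 1 (2*n) (\<lambda>_. 1)) (mat_of_cols (dim_vec c) [c]))"

text \<open>For \<open>k \<ge> 1\<close>, a field \<open>\<dots>_sub\<close> at \<open>k\<close> and \<open>m\<close> holds the quantity with superscript \<open>(m)\<close> and
  index \<open>k-1|k-1\<close>; \<open>\<dots>_pred\<close> at \<open>k\<close> has index \<open>k|k-1\<close> and \<open>\<dots>_filt\<close> at \<open>k\<close> has index \<open>k|k\<close>.
  The values outside \<open>1 \<le> k \<le> horizon\<close> (\<open>0 \<le> k\<close> for \<open>\<dots>_filt\<close>) and \<open>m \<le> substeps\<close> are irrelevant.\<close>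

record filter_run =
  x_sub :: "nat \<Rightarrow> nat \<Rightarrow> real vec"
  x_pred :: "nat \<Rightarrow> real vec"
  z_pred :: "nat \<Rightarrow> real vec"
  x_filt :: "nat \<Rightarrow> real vec"
  cross_cov :: "nat \<Rightarrow> real mat"
  gain :: "nat \<Rightarrow> real mat"

text \<open>\<open>svdQ\<close>, \<open>svdD\<close> are the factors chosen when a covariance is decomposed.\<close>

record conv_run = filter_run +
  cov_sub :: "nat \<Rightarrow> nat \<Rightarrow> real mat"
  cov_pred :: "nat \<Rightarrow> real mat"
  cov_innov :: "nat \<Rightarrow> real mat"
  cov_filt :: "nat \<Rightarrow> real mat"
  svdQ_sub :: "nat \<Rightarrow> nat \<Rightarrow> real mat"
  svdD_sub :: "nat \<Rightarrow> nat \<Rightarrow> real mat"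
  svdQ_pred :: "nat \<Rightarrow> real mat"
  svdD_pred :: "nat \<Rightarrow> real mat"

text \<open>\<open>Dh\<close> stands for the matrix written \<open>D^{1/2}\<close>, whose square is \<open>D\<close>.\<close>

record svd_run = filter_run +
  Q_init :: "real mat"
  D_init :: "real mat"
  Q_proc :: "real mat"
  D_proc :: "real mat"
  Q_meas :: "nat \<Rightarrow> real mat"
  D_meas :: "nat \<Rightarrow> real mat"
  Q_sub :: "nat \<Rightarrow> nat \<Rightarrow> real mat"
  Dh_sub :: "nat \<Rightarrow> nat \<Rightarrow> real mat"
  Q_pred :: "nat \<Rightarrow> real mat"
  Dh_pred :: "nat \<Rightarrow> real mat"
  Q_innov :: "nat \<Rightarrow> real mat"
  Dh_innov :: "nat \<Rightarrow> real mat"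
  Q_filt :: "nat \<Rightarrow> real mat"
  Dh_filt :: "nat \<Rightarrow> real mat"

definition diag_sq :: "real mat \<Rightarrow> real mat" where
  "diag_sq D = D * D"

definition conv_time_update :: "ckf_data \<Rightarrow> conv_run \<Rightarrow> nat \<Rightarrow> bool" where
  "conv_time_update d a k \<longleftrightarrow>
     x_sub a k 0 = x_filt a (k - 1) \<and>
     cov_sub a k 0 = cov_filt a (k - 1) \<and>
     (\<forall>m<substeps d.
        is_psd_svd (cov_sub a k m) (svdQ_sub a k m) (svdD_sub a k m) \<and>
        (let n = dim_x d;
             S = svdQ_sub a k m * diag_sqrt (svdD_sub a k m);
             Y = propagated_nodes d k m (cubature_nodes n S (x_sub a k m));
             X = scaled_dev n Y (x_sub a k (Suc m))
         in x_sub a k (Suc m) = node_mean n Y \<and>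
            cov_sub a k (Suc m) =
              X * transpose_mat X +
              substep d \<cdot>\<^sub>m (diffusion d * proc_cov d * transpose_mat (diffusion d)))) \<and>
     x_pred a k = x_sub a k (substeps d) \<and>
     cov_pred a k = cov_sub a k (substeps d)"

definition conv_meas_update :: "ckf_data \<Rightarrow> conv_run \<Rightarrow> nat \<Rightarrow> bool" where
  "conv_meas_update d a k \<longleftrightarrow>
     is_psd_svd (cov_pred a k) (svdQ_pred a k) (svdD_pred a k) \<and>
     (let n = dim_x d;
          S = svdQ_pred a k * diag_sqrt (svdD_pred a k);
          Y = cubature_nodes n S (x_pred a k);
          H = observed_nodes d k Y;
          X = scaled_dev n Y (x_pred a k);
          Z = scaled_dev n H (z_pred a k)
      in z_pred a k = node_mean n H \<and>
         cov_innov a k = Z * transpose_mat Z + meas_cov d k \<and>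
         cross_cov a k = X * transpose_mat Z \<and>
         invertible_mat (cov_innov a k) \<and>
         gain a k = cross_cov a k * mat_inv (cov_innov a k) \<and>
         x_filt a k = x_pred a k + gain a k *\<^sub>v (meas d k - z_pred a k) \<and>
         cov_filt a k = cov_pred a k - gain a k * cov_innov a k * transpose_mat (gain a k))"

definition conv_ckf_run :: "ckf_data \<Rightarrow> conv_run \<Rightarrow> bool" where
  "conv_ckf_run d a \<longleftrightarrow>
     x_filt a 0 = init_mean d \<and> cov_filt a 0 = init_cov d \<and>
     (\<forall>k\<in>{1..horizon d}. conv_time_update d a k \<and> conv_meas_update d a k)"

definition svd_time_update :: "ckf_data \<Rightarrow> svd_run \<Rightarrow> nat \<Rightarrow> bool" where
  "svd_time_update d b k \<longleftrightarrow>
     x_sub b k 0 = x_filt b (k - 1) \<and>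
     Q_sub b k 0 = Q_filt b (k - 1) \<and>
     Dh_sub b k 0 = Dh_filt b (k - 1) \<and>
     (\<forall>m<substeps d.
        (let n = dim_x d;
             S = Q_sub b k m * Dh_sub b k m;
             Y = propagated_nodes d k m (cubature_nodes n S (x_sub b k m));
             X = scaled_dev n Y (x_sub b k (Suc m));
             T = hcat X (sqrt (substep d) \<cdot>\<^sub>m (diffusion d * Q_proc b * diag_sqrt (D_proc b)))
         in x_sub b k (Suc m) = node_mean n Y \<and>
            svd_econ T (Q_sub b k (Suc m)) (Dh_sub b k (Suc m)))) \<and>
     x_pred b k = x_sub b k (substeps d) \<and>
     Q_pred b k = Q_sub b k (substeps d) \<and>
     Dh_pred b k = Dh_sub b k (substeps d)"

text \<open>Invertibility of \<open>D\<^sub>R\<^sub>e\<close> is not demanded; it follows from positive definiteness of the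
  measurement noise covariance.\<close>

definition svd_meas_update :: "ckf_data \<Rightarrow> svd_run \<Rightarrow> nat \<Rightarrow> bool" where
  "svd_meas_update d b k \<longleftrightarrow>
     (let n = dim_x d;
          S = Q_pred b k * Dh_pred b k;
          Y = cubature_nodes n S (x_pred b k);
          H = observed_nodes d k Y;
          X = scaled_dev n Y (x_pred b k);
          Z = scaled_dev n H (z_pred b k);
          SR = Q_meas b k * diag_sqrt (D_meas b k)
      in z_pred b k = node_mean n H \<and>
         svd_econ (hcat Z SR) (Q_innov b k) (Dh_innov b k) \<and>
         cross_cov b k = X * transpose_mat Z \<and>
         gain b k = cross_cov b k * Q_innov b k * mat_inv (diag_sq (Dh_innov b k))
                      * transpose_mat (Q_innov b k) \<and>
         x_filt b k = x_pred b k + gain b k *\<^sub>v (meas d k - z_pred b k) \<and>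
         svd_econ (hcat (X - gain b k * Z) (gain b k * SR)) (Q_filt b k) (Dh_filt b k))"

definition svd_ckf_run :: "ckf_data \<Rightarrow> svd_run \<Rightarrow> bool" where
  "svd_ckf_run d b \<longleftrightarrow>
     is_psd_svd (proc_cov d) (Q_proc b) (D_proc b) \<and>
     (\<forall>k\<in>{1..horizon d}. is_psd_svd (meas_cov d k) (Q_meas b k) (D_meas b k)) \<and>
     is_psd_svd (init_cov d) (Q_init b) (D_init b) \<and>
     x_filt b 0 = init_mean d \<and>
     Q_filt b 0 = Q_init b \<and> Dh_filt b 0 = diag_sqrt (D_init b) \<and>
     (\<forall>k\<in>{1..horizon d}. svd_time_update d b k \<and> svd_meas_update d b k)"

text \<open>Wherever the conventional filter decomposes a covariance, it picks the factors carried by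
  the SVD-based filter.\<close>

definition same_svd_choices :: "ckf_data \<Rightarrow> conv_run \<Rightarrow> svd_run \<Rightarrow> bool" where
  "same_svd_choices d a b \<longleftrightarrow>
     (\<forall>k\<in>{1..horizon d}.
        (\<forall>m<substeps d. svdQ_sub a k m = Q_sub b k m \<and> svdD_sub a k m = diag_sq (Dh_sub b k m)) \<and>
        svdQ_pred a k = Q_pred b k \<and> svdD_pred a k = diag_sq (Dh_pred b k))"

end

theory Submission
  imports Defs "Jordan_Normal_Form.Determinant"
begin

text \<open>Each economy-size SVD of the SVD-based filter is applied to a block row whose Gram matrix is the
  covariance that the conventional filter computes at that point. From \<open>A = W [S, 0] V\<^sup>T\<close> with
  \<open>V\<close> orthogonal one gets \<open>A A\<^sup>T = W S\<^sup>2 W\<^sup>T\<close> (\<open>svd_econ_gram\<close>), while the Gram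
  matrix of a block row is the sum of the Gram matrices of its blocks (\<open>hcat_gram\<close>). For the time
  update and the innovation covariance this is all: the blocks are the centred points and a square
  root of the noise covariance. Invertibility of the innovation covariance, needed for the gains to
  coincide, comes from positive definiteness of the measurement noise
  (\<open>gram_plus_pos_def_inverse\<close>, \<open>mat_inv_orthonormal_conj\<close>).

  The filtered covariance needs two further facts. The pre-array of the SVD-based filter encodes the
  Joseph form \<open>(X - K Z)(X - K Z)\<^sup>T + K R K\<^sup>T\<close>, which for the optimal gain equals
  \<open>X X\<^sup>T - K R\<^sub>e K\<^sup>T\<close> (\<open>joseph_form\<close>); and \<open>X X\<^sup>T\<close> is the predicted covariance
  because the cubature points reproduce the covariance they are drawn from
  (\<open>cubature_dev_gram\<close>).

  These identities say that the covariances \<open>Q D Q\<^sup>T\<close> assembled from the SVD-based run satisfy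
  the equations of the conventional filter, which gives a conventional run with the prescribed SVD
  choices. Conversely, in a conventional run with these choices the chosen factors determine every
  decomposed covariance and the square root used for the cubature points, so the estimates agree by
  induction on time.\<close>

definition cov_of_factors :: "real mat \<Rightarrow> real mat \<Rightarrow> real mat" where
  "cov_of_factors Q Dh = Q * diag_sq Dh * transpose_mat Q"

text \<open>An economy-size SVD delivers the square root of the diagonal of the covariance; since its
  entries are nonnegative and sorted, the squared diagonal is a legitimate SVD factor.\<close>

definition sqrt_factors :: "nat \<Rightarrow> real mat \<Rightarrow> real mat \<Rightarrow> bool" where
  "sqrt_factors n Q Dh \<longleftrightarrow> orthonormal_mat n Q \<and> nonneg_diag_mat n Dh \<and> nonincreasing_diag n Dh"

section \<open>Square roots of nonnegative diagonal matrices\<close>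

lemma orthonormal_matD:
  assumes "orthonormal_mat n Q"
  shows "Q \<in> carrier_mat n n" "Q * transpose_mat Q = 1\<^sub>m n" "transpose_mat Q * Q = 1\<^sub>m n"
  using assms by (auto simp: orthonormal_mat_def)

lemma nonneg_diag_mat_carrier: "nonneg_diag_mat n D \<Longrightarrow> D \<in> carrier_mat n n"
  by (simp add: nonneg_diag_mat_def)

lemma transpose_diag_mat:
  assumes "nonneg_diag_mat n D"
  shows "transpose_mat D = D"
  using assms unfolding nonneg_diag_mat_def diagonal_mat_def
  by (intro eq_matI) (metis carrier_matD index_transpose_mat, auto)

lemma diag_sq_index:
  assumes "nonneg_diag_mat n D" "i < n" "j < n"
  shows "diag_sq D $$ (i,j) = (if i = j then (D $$ (i,i))\<^sup>2 else 0)"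
proof -
  have D: "D \<in> carrier_mat n n" and off: "\<And>i j. i < n \<Longrightarrow> j < n \<Longrightarrow> i \<noteq> j \<Longrightarrow> D $$ (i,j) = 0"
    using assms(1) by (auto simp: nonneg_diag_mat_def diagonal_mat_def)
  have "diag_sq D $$ (i,j) = (\<Sum>l\<in>{0..<n}. D $$ (i,l) * D $$ (l,j))"
    using D assms(2,3) by (simp add: diag_sq_def scalar_prod_def)
  also have "\<dots> = (\<Sum>l\<in>{0..<n}. if l = i then D $$ (i,i) * D $$ (i,j) else 0)"
    using off assms(2) by (intro sum.cong) auto
  also have "\<dots> = D $$ (i,i) * D $$ (i,j)"
    using assms(2) by simp
  finally show ?thesis
    using off assms(2,3) by (auto simp: power2_eq_square)
qed

lemma diag_sq_carrier: "nonneg_diag_mat n D \<Longrightarrow> diag_sq D \<in> carrier_mat n n"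
  by (auto simp: nonneg_diag_mat_def diag_sq_def)

lemma nonneg_diag_mat_diag_sq: "nonneg_diag_mat n D \<Longrightarrow> nonneg_diag_mat n (diag_sq D)"
  unfolding nonneg_diag_mat_def[of n "diag_sq D"] diagonal_mat_def
  using diag_sq_carrier diag_sq_index by fastforce

lemma nonneg_diag_mat_diag_sqrt: "nonneg_diag_mat n D \<Longrightarrow> nonneg_diag_mat n (diag_sqrt D)"
  unfolding nonneg_diag_mat_def diagonal_mat_def diag_sqrt_def by auto

lemma nonincreasing_diag_sqrt:
  assumes "nonneg_diag_mat n D" "nonincreasing_diag n D"
  shows "nonincreasing_diag n (diag_sqrt D)"
  using assms unfolding nonincreasing_diag_def nonneg_diag_mat_def diag_sqrt_def by auto

lemma nonincreasing_diag_sq: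
  assumes "nonneg_diag_mat n D" "nonincreasing_diag n D"
  shows "nonincreasing_diag n (diag_sq D)"
  using assms unfolding nonincreasing_diag_def
  by (auto simp: diag_sq_index nonneg_diag_mat_def intro!: power_mono)

lemma diag_sqrt_diag_sq:
  assumes "nonneg_diag_mat n D"
  shows "diag_sqrt (diag_sq D) = D"
proof (rule eq_matI)
  show "dim_row (diag_sqrt (diag_sq D)) = dim_row D" "dim_col (diag_sqrt (diag_sq D)) = dim_col D"
    by (auto simp: diag_sqrt_def diag_sq_def)
  fix i j assume "i < dim_row D" "j < dim_col D"
  then have "i < n" "j < n" using assms by (auto simp: nonneg_diag_mat_def)
  then show "diag_sqrt (diag_sq D) $$ (i,j) = D $$ (i,j)"
    using assms diag_sq_carrier[OF assms]
    by (auto simp: diag_sqrt_def diag_sq_index nonneg_diag_mat_def diagonal_mat_def)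
qed

lemma diag_sq_diag_sqrt:
  assumes "nonneg_diag_mat n D"
  shows "diag_sq (diag_sqrt D) = D"
proof (rule eq_matI)
  show "dim_row (diag_sq (diag_sqrt D)) = dim_row D" "dim_col (diag_sq (diag_sqrt D)) = dim_col D"
    by (auto simp: diag_sqrt_def diag_sq_def)
  fix i j assume "i < dim_row D" "j < dim_col D"
  then have ij: "i < n" "j < n" using assms by (auto simp: nonneg_diag_mat_def)
  have "diag_sq (diag_sqrt D) $$ (i,j) = (if i = j then (diag_sqrt D $$ (i,i))\<^sup>2 else 0)"
    using diag_sq_index[OF nonneg_diag_mat_diag_sqrt[OF assms] ij] .
  then show "diag_sq (diag_sqrt D) $$ (i,j) = D $$ (i,j)"
    using assms ij by (auto simp: diag_sqrt_def nonneg_diag_mat_def diagonal_mat_def)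
qed

section \<open>Gram matrices of square roots, block rows and economy-size SVDs\<close>

lemma factor_gram:
  assumes Q: "Q \<in> carrier_mat m n" and E: "nonneg_diag_mat n E"
  shows "(Q * E) * transpose_mat (Q * E) = Q * diag_sq E * transpose_mat Q"
proof -
  have E': "E \<in> carrier_mat n n" using E by (rule nonneg_diag_mat_carrier)
  have "(Q * E) * transpose_mat (Q * E) = (Q * E) * (E * transpose_mat Q)"
    using Q E' by (simp add: transpose_mult transpose_diag_mat[OF E])
  also have "\<dots> = (Q * (E * E)) * transpose_mat Q"
    using Q E' by (simp add: assoc_mult_mat[of _ m n _ n _ n] assoc_mult_mat[of _ m n _ n _ m]
        assoc_mult_mat[of _ n n _ n _ m])
  finally show ?thesis by (simp add: diag_sq_def)
qed

lemma is_psd_svd_carrier: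
  assumes "is_psd_svd P Q D" "P \<in> carrier_mat n n"
  shows "Q \<in> carrier_mat n n" "diag_sqrt D \<in> carrier_mat n n"
proof -
  have "orthonormal_mat (dim_row P) Q" "nonneg_diag_mat (dim_row P) D"
    using assms(1) unfolding is_psd_svd_def spectral_factors_def by blast+
  then show "Q \<in> carrier_mat n n" "diag_sqrt D \<in> carrier_mat n n"
    using assms(2) orthonormal_matD(1) nonneg_diag_mat_carrier[OF nonneg_diag_mat_diag_sqrt] by auto
qed

lemma is_psd_svd_root_gram:
  assumes "is_psd_svd P Q D"
  shows "(Q * diag_sqrt D) * transpose_mat (Q * diag_sqrt D) = P"
proof -
  let ?n = "dim_row P"
  have P: "P = Q * D * transpose_mat Q" and Q: "orthonormal_mat ?n Q" and D: "nonneg_diag_mat ?n D"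
    using assms by (auto simp only: is_psd_svd_def spectral_factors_def)
  show ?thesis
    using factor_gram[OF orthonormal_matD(1)[OF Q] nonneg_diag_mat_diag_sqrt[OF D]] P
    by (simp add: diag_sq_diag_sqrt[OF D])
qed

lemma is_psd_svd_sqrt_factors:
  assumes "is_psd_svd P Q D" "dim_row P = n"
  shows "sqrt_factors n Q (diag_sqrt D)" "cov_of_factors Q (diag_sqrt D) = P"
  using assms
  by (auto simp: is_psd_svd_def spectral_factors_def sqrt_factors_def cov_of_factors_def
      nonneg_diag_mat_diag_sqrt nonincreasing_diag_sqrt diag_sq_diag_sqrt)

text \<open>This is what lets the conventional filter adopt the factors of the SVD-based one at each of its
  decompositions.\<close>

lemma is_psd_svd_cov_of_factors:
  assumes "sqrt_factors n Q Dh"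
  shows "is_psd_svd (cov_of_factors Q Dh) Q (diag_sq Dh)"
  using assms orthonormal_matD(1)[of n Q]
  by (simp add: is_psd_svd_def spectral_factors_def sqrt_factors_def cov_of_factors_def
      nonneg_diag_mat_diag_sq nonincreasing_diag_sq)

lemma hcat_carrier:
  "A \<in> carrier_mat p q \<Longrightarrow> B \<in> carrier_mat p r \<Longrightarrow> hcat A B \<in> carrier_mat p (q + r)"
  by (auto simp: hcat_def)

text \<open>Stacking square roots side by side adds the matrices that they factorize. Each
  pre-array of the SVD-based filter is built this way from the two terms of a covariance.\<close>

lemma hcat_gram:
  assumes A: "A \<in> carrier_mat p q" and B: "B \<in> carrier_mat p r"
  shows "hcat A B * transpose_mat (hcat A B) = A * transpose_mat A + B * transpose_mat B"
proof -
  have t: "transpose_mat (hcat A B)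
      = four_block_mat (transpose_mat A) (0\<^sub>m q 0) (transpose_mat B) (0\<^sub>m r 0)"
    using A B by (simp add: hcat_def transpose_four_block_mat[of _ p q _ r _ 0])
  have "hcat A B * transpose_mat (hcat A B) =
      four_block_mat (A * transpose_mat A + B * transpose_mat B) (A * 0\<^sub>m q 0 + B * 0\<^sub>m r 0)
        (0\<^sub>m 0 q * transpose_mat A + 0\<^sub>m 0 r * transpose_mat B) (0\<^sub>m 0 q * 0\<^sub>m q 0 + 0\<^sub>m 0 r * 0\<^sub>m r 0)"
    unfolding t unfolding hcat_def using A B
    by (simp add: mult_four_block_mat[of _ p q _ r _ 0 _ _ p _ 0])
  also have "\<dots> = A * transpose_mat A + B * transpose_mat B"
    using A B by (intro eq_matI) auto
  finally show ?thesis .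
qed

lemma svd_econ_sqrt_factors:
  assumes "svd_econ A W S" "dim_row A = p"
  shows "sqrt_factors p W S"
  using assms by (auto simp: svd_econ_def sqrt_factors_def Let_def)

text \<open>The right orthogonal factor cancels in the Gram matrix, so discarding it loses nothing about the
  covariance.\<close>

lemma svd_econ_gram:
  assumes "svd_econ A W S"
  shows "A * transpose_mat A = cov_of_factors W S"
proof -
  define p q where "p = dim_row A" and "q = dim_col A"
  obtain V where pq: "p \<le> q" and W: "orthonormal_mat p W" and S: "nonneg_diag_mat p S"
    and V: "orthonormal_mat q V" and A: "A = W * hcat S (0\<^sub>m p (q - p)) * transpose_mat V"
    using assms unfolding svd_econ_def Let_def p_def q_def by blast
  define H where "H = hcat S (0\<^sub>m p (q - p))"
  have Sc: "S \<in> carrier_mat p p" and Wc: "W \<in> carrier_mat p p" and Vc: "V \<in> carrier_mat q q"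
    using S W V by (auto simp: nonneg_diag_mat_def orthonormal_mat_def)
  have Hc: "H \<in> carrier_mat p q"
    using hcat_carrier[OF Sc, of "0\<^sub>m p (q-p)" "q-p"] pq by (simp add: H_def)
  have HH: "H * transpose_mat H = diag_sq S"
    using hcat_gram[OF Sc, of "0\<^sub>m p (q-p)" "q-p"] Sc transpose_diag_mat[OF S]
    by (simp add: H_def diag_sq_def)
  define U where "U = W * H"
  have Uc: "U \<in> carrier_mat p q" using Wc Hc by (simp add: U_def)
  have A': "A = U * transpose_mat V" using A by (simp add: H_def U_def)
  have "A * transpose_mat A = (U * transpose_mat V) * (V * transpose_mat U)"
    using Uc Vc by (simp add: A' transpose_mult[of U p q _ q])
  also have "\<dots> = U * ((transpose_mat V * V) * transpose_mat U)"
    using Uc Vc by (simp add: assoc_mult_mat[of U p q _ q _ p] assoc_mult_mat[of _ q q V q _ p])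
  also have "\<dots> = (W * H) * (transpose_mat H * transpose_mat W)"
    using Uc Wc Hc by (simp add: orthonormal_matD(3)[OF V] U_def transpose_mult[of W p p H q])
  also have "\<dots> = W * (H * transpose_mat H) * transpose_mat W"
    using Wc Hc by (simp add: assoc_mult_mat[of W p p _ q _ p] assoc_mult_mat[of W p p _ p _ p]
        assoc_mult_mat[of H p q _ p _ p])
  finally show ?thesis by (simp add: HH cov_of_factors_def)
qed

section \<open>The inverse innovation covariance\<close>

lemma mat_inv_eqI:
  assumes A: "A \<in> carrier_mat n n" and B: "B \<in> carrier_mat n n"
    and AB: "A * B = 1\<^sub>m n" "B * A = 1\<^sub>m n"
  shows "mat_inv A = B"
proof (cases "mat_inverse A")
  case None
  have "A \<in> Units (ring_mat TYPE(real) n undefined)"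
    using A B AB by (auto simp: Units_def ring_mat_def)
  with mat_inverse(1)[OF A None, of undefined] show ?thesis by blast
next
  case (Some C)
  from mat_inverse(2)[OF A Some] have C: "C * A = 1\<^sub>m n" "C \<in> carrier_mat n n" by auto
  have "C = C * (A * B)" using C AB by (simp add: right_mult_one_mat')
  also have "\<dots> = (C * A) * B" using assoc_mult_mat[OF C(2) A B] by (rule sym)
  also have "\<dots> = B" using B by (simp only: C(1)) simp
  finally show ?thesis using Some by (simp add: mat_inv_def)
qed

text \<open>A vector \<open>v\<close> in the kernel would give
  \<open>0 = \<bar>Z\<^sup>T v\<bar>\<^sup>2 + v\<^sup>T R v\<close>, where the second term is positive unless \<open>v = 0\<close>.\<close>

lemma gram_plus_pos_def_inverse:
  assumes Z: "Z \<in> carrier_mat p q" and R: "pos_def_mat p R"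
  obtains B where "B \<in> carrier_mat p p"
    "(Z * transpose_mat Z + R) * B = 1\<^sub>m p" "B * (Z * transpose_mat Z + R) = 1\<^sub>m p"
proof -
  let ?A = "Z * transpose_mat Z + R"
  have Rc: "R \<in> carrier_mat p p" using R by (simp add: pos_def_mat_def)
  have A: "?A \<in> carrier_mat p p" using Z Rc by simp
  have "det ?A \<noteq> 0"
  proof
    assume "det ?A = 0"
    then obtain v where v: "v \<in> carrier_vec p" "v \<noteq> 0\<^sub>v p" "?A *\<^sub>v v = 0\<^sub>v p"
      using det_0_iff_vec_prod_zero[OF A] by blast
    let ?w = "transpose_mat Z *\<^sub>v v"
    have w: "?w \<in> carrier_vec q" using Z v by simp
    have "0 = v \<bullet> (?A *\<^sub>v v)" using v by simp
    also have "?A *\<^sub>v v = Z *\<^sub>v ?w + R *\<^sub>v v"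
      using Z Rc v by (simp add: add_mult_distrib_mat_vec[of _ p p])
    also have "v \<bullet> \<dots> = v \<bullet> (Z *\<^sub>v ?w) + v \<bullet> (R *\<^sub>v v)"
      using Z Rc v by (simp add: scalar_prod_add_distrib[of _ p])
    also have "v \<bullet> (Z *\<^sub>v ?w) = ?w \<bullet> ?w"
      using transpose_vec_mult_scalar[OF Z w v(1)] by simp
    finally have "?w \<bullet> ?w + v \<bullet> (R *\<^sub>v v) = 0" by simp
    moreover have "?w \<bullet> ?w \<ge> 0" by (simp add: scalar_prod_def sum_nonneg)
    moreover have "v \<bullet> (R *\<^sub>v v) > 0" using R v by (simp add: pos_def_mat_def)
    ultimately show False by linarith
  qed
  from det_non_zero_imp_unit[OF A this, of undefined] obtain B where
    "B \<in> carrier_mat p p" "?A * B = 1\<^sub>m p" "B * ?A = 1\<^sub>m p"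
    by (auto simp: Units_def ring_mat_def)
  then show thesis by (rule that)
qed

lemma orthonormal_conj_cancel:
  assumes Q: "orthonormal_mat n Q" and B: "B \<in> carrier_mat n n"
  shows "Q * (transpose_mat Q * B * Q) * transpose_mat Q = B"
    and "transpose_mat Q * (Q * B * transpose_mat Q) * Q = B"
proof -
  note Qc = orthonormal_matD(1)[OF Q]
  have Qt: "transpose_mat Q \<in> carrier_mat n n" using Qc by simp
  have "Q * (transpose_mat Q * B * Q) * transpose_mat Q = (Q * transpose_mat Q) * B * (Q * transpose_mat Q)"
    using Qc Qt B by (simp add: assoc_mult_mat[of _ n n _ n _ n] mult_carrier_mat[of _ n n])
  then show "Q * (transpose_mat Q * B * Q) * transpose_mat Q = B"
    using B by (simp add: orthonormal_matD[OF Q])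
  have "transpose_mat Q * (Q * B * transpose_mat Q) * Q = (transpose_mat Q * Q) * B * (transpose_mat Q * Q)"
    using Qc Qt B by (simp add: assoc_mult_mat[of _ n n _ n _ n] mult_carrier_mat[of _ n n])
  then show "transpose_mat Q * (Q * B * transpose_mat Q) * Q = B"
    using B by (simp add: orthonormal_matD[OF Q])
qed

text \<open>Conjugation by \<open>Q\<close> transports the inverse of \<open>A\<close> to the inverse of \<open>D\<close>, so
  invertibility of the innovation covariance carries over to its diagonal factor.\<close>

lemma
  assumes Q: "orthonormal_mat n Q" and D: "D \<in> carrier_mat n n"
    and A: "A = Q * D * transpose_mat Q"
    and B: "B \<in> carrier_mat n n" "A * B = 1\<^sub>m n" "B * A = 1\<^sub>m n"
  shows mat_inv_orthonormal_conj: "Q * mat_inv D * transpose_mat Q = mat_inv A"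
    and mat_inv_orthonormal_conj_carrier: "mat_inv D \<in> carrier_mat n n"
proof -
  note Qc = orthonormal_matD(1)[OF Q]
  let ?C = "transpose_mat Q * B * Q"
  have Qt: "transpose_mat Q \<in> carrier_mat n n" and Ac: "A \<in> carrier_mat n n"
    using Qc D A by simp_all
  have DA: "D = transpose_mat Q * A * Q"
    unfolding A by (rule orthonormal_conj_cancel(2)[OF Q D, symmetric])
  have conj: "(transpose_mat Q * U * Q) * (transpose_mat Q * V * Q) = 1\<^sub>m n"
    if U: "U \<in> carrier_mat n n" and V: "V \<in> carrier_mat n n" and UV: "U * V = 1\<^sub>m n" for U V
  proof -
    have "(transpose_mat Q * U * Q) * (transpose_mat Q * V * Q)
        = transpose_mat Q * (U * ((Q * transpose_mat Q) * V)) * Q"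
      using Qc Qt U V by (simp add: assoc_mult_mat[of _ n n _ n _ n] mult_carrier_mat[of _ n n])
    also have "\<dots> = 1\<^sub>m n"
      using right_mult_one_mat[OF Qt] V by (simp add: orthonormal_matD[OF Q] UV)
    finally show ?thesis .
  qed
  have "D * ?C = 1\<^sub>m n" "?C * D = 1\<^sub>m n"
    unfolding DA using conj Ac B by blast+
  then have C: "mat_inv D = ?C" using mat_inv_eqI[OF D, of ?C] Qc Qt B by simp
  then show "mat_inv D \<in> carrier_mat n n" using Qc Qt B by simp
  show "Q * mat_inv D * transpose_mat Q = mat_inv A"
    unfolding C using orthonormal_conj_cancel(1)[OF Q B(1)] mat_inv_eqI[OF Ac B] by simp
qed

lemma invertible_matI:
  fixes A B :: "real mat"
  assumes "A \<in> carrier_mat n n" "B \<in> carrier_mat n n" "A * B = 1\<^sub>m n" "B * A = 1\<^sub>m n"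
  shows "invertible_mat A"
  using assms unfolding invertible_mat_def inverts_mat_def by auto

section \<open>The stabilized covariance update and the cubature points\<close>

text \<open>The Joseph form of the Kalman covariance update. With \<open>R\<^sub>e = Z Z\<^sup>T + G G\<^sup>T\<close>, expanding the
  left-hand side gives \<open>X X\<^sup>T - K Z X\<^sup>T - X Z\<^sup>T K\<^sup>T + K R\<^sub>e K\<^sup>T\<close>. The gain equation turns
  \<open>X Z\<^sup>T K\<^sup>T\<close> into \<open>K R\<^sub>e K\<^sup>T\<close>, and by symmetry of \<open>R\<^sub>e\<close> its transpose \<open>K Z X\<^sup>T\<close> as well;
  two of the three copies cancel.\<close>

lemma joseph_form:
  fixes X Z K G :: "real mat"
  assumes X: "X \<in> carrier_mat n q" and Z: "Z \<in> carrier_mat p q"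
    and K: "K \<in> carrier_mat n p" and G: "G \<in> carrier_mat p r"
    and KRe: "K * (Z * transpose_mat Z + G * transpose_mat G) = X * transpose_mat Z"
  shows "(X - K * Z) * transpose_mat (X - K * Z) + (K * G) * transpose_mat (K * G)
    = X * transpose_mat X - K * (Z * transpose_mat Z + G * transpose_mat G) * transpose_mat K"
proof -
  let ?K = "transpose_mat K" and ?X = "transpose_mat X" and ?Z = "transpose_mat Z" and ?G = "transpose_mat G"
  have c: "?K \<in> carrier_mat p n" "?X \<in> carrier_mat q n" "?Z \<in> carrier_mat q p" "?G \<in> carrier_mat r p"
    using assms by simp_all
  define Y where "Y = K * Z"
  have Y: "Y \<in> carrier_mat n q" using K Z by (simp add: Y_def)
  have Yt: "transpose_mat Y = ?Z * ?K" using K Z by (simp add: Y_def transpose_mult[of _ n p _ q])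
  have "(X - Y) * transpose_mat (X - Y) = (X - Y) * ?X - (X - Y) * transpose_mat Y"
    using X Y mult_minus_distrib_mat[of "X - Y" n q ?X n "transpose_mat Y"]
    by (simp add: transpose_minus[of _ n q] minus_carrier_mat)
  also have "\<dots> = X * ?X - Y * ?X - (X * transpose_mat Y - Y * transpose_mat Y)"
    using X Y by (simp add: minus_mult_distrib_mat[of _ n q _ _ n])
  finally have "(X - Y) * transpose_mat (X - Y)
     = X * ?X - Y * ?X - (X * transpose_mat Y - Y * transpose_mat Y)" .
  note 1 = this[unfolded Yt, unfolded Y_def]
  define M where "M = Z * ?Z + G * ?G"
  have M: "M \<in> carrier_mat p p" using Z G by (simp add: M_def)
  have Mt: "transpose_mat M = M"
    using Z G c by (simp add: M_def transpose_add[of _ p p] transpose_mult[of _ p q _ p] transpose_mult[of _ p r _ p])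
  have XZK: "X * (?Z * ?K) = K * M * ?K"
    using assoc_mult_mat[OF X c(3,1)] by (simp only: KRe M_def)
  have "K * Z * ?X = transpose_mat (X * (?Z * ?K))"
    using X Y transpose_mult[of X n q "transpose_mat Y" n] by (simp only: Yt[symmetric]) (simp add: Y_def)
  also have "\<dots> = transpose_mat (K * (M * ?K))"
    unfolding XZK using assoc_mult_mat[OF K M c(1)] by simp
  also have "\<dots> = K * M * ?K"
    using K M c transpose_mult[of K n p "M * ?K" n] transpose_mult[of M p p ?K n]
    by (simp add: Mt)
  finally have KZX: "K * Z * ?X = K * M * ?K" .
  have "(K * Z) * (?Z * ?K) + (K * G) * transpose_mat (K * G)
      = K * (Z * ?Z * ?K + G * ?G * ?K)"
    using K Z G c mult_add_distrib_mat[of K n p "Z * ?Z * ?K" n "G * ?G * ?K"]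
      assoc_mult_mat[of K n p Z q "?Z * ?K" n] assoc_mult_mat[of K n p G r "?G * ?K" n]
    by (simp add: transpose_mult[of K n p G r])
  also have "\<dots> = K * M * ?K"
    using K M c add_mult_distrib_mat[of "Z * ?Z" p p "G * ?G" ?K n] Z G
      assoc_mult_mat[OF K M c(1)] by (simp add: M_def)
  finally have 2: "(K * Z) * (?Z * ?K) + (K * G) * transpose_mat (K * G) = K * M * ?K" .
  define U where "U = K * M * ?K"
  define V where "V = (K * Z) * (?Z * ?K)"
  define W where "W = (K * G) * transpose_mat (K * G)"
  have UV: "U \<in> carrier_mat n n" "V \<in> carrier_mat n n" "W \<in> carrier_mat n n" "X * ?X \<in> carrier_mat n n"
    using X Z K G M c unfolding U_def V_def W_def by auto
  have VW: "V + W = U" using 2 by (simp only: U_def V_def W_def)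
  have "X * ?X - U - (U - V) + W = X * ?X - U"
    unfolding VW[symmetric] using UV by (intro eq_matI) auto
  then show ?thesis
    unfolding 1 XZK KZX U_def V_def W_def M_def .
qed

lemma scaled_dev_carrier:
  assumes "c \<in> carrier_vec p"
  shows "scaled_dev n X c \<in> carrier_mat p (2*n)"
  using assms by (auto simp: scaled_dev_def kron_def)

text \<open>The points \<open>\<plusminus>\<surd>n e\<^sub>i\<close> are scaled so that the centred and normalized point matrix is
  \<open>[S, -S] / \<surd>2\<close>; the covariance of the cubature points is exactly the one they were drawn from.
  This makes \<open>X X\<^sup>T\<close> in the SVD-based measurement update equal to the predicted covariance that
  the conventional filter subtracts from.\<close>

lemma cubature_dev_gram:
  assumes n: "0 < n" and S: "S \<in> carrier_mat n n" and x: "x \<in> carrier_vec n"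
  shows "scaled_dev n (cubature_nodes n S x) x * transpose_mat (scaled_dev n (cubature_nodes n S x) x)
    = S * transpose_mat S"
proof -
  let ?X = "scaled_dev n (cubature_nodes n S x) x"
  have split: "?X = hcat ((1 / sqrt 2) \<cdot>\<^sub>m S) ((- 1 / sqrt 2) \<cdot>\<^sub>m S)" (is "_ = ?H")
  proof (rule eq_matI)
    show "dim_row ?X = dim_row ?H" "dim_col ?X = dim_col ?H"
      using S x by (auto simp: scaled_dev_def kron_def hcat_def)
    fix i j assume "i < dim_row ?H" "j < dim_col ?H"
    then have ij: "i < n" "j < 2 * n" using S by (auto simp: hcat_def)
    let ?u = "cubature_vec n j"
    have Su: "(S *\<^sub>v ?u) $ i = (if j < n then sqrt n * S $$ (i,j) else - sqrt n * S $$ (i, j - n))"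
    proof (cases "j < n")
      case True
      then show ?thesis using S ij by (simp add: cubature_vec_def)
    next
      case False
      then show ?thesis using S ij by (simp add: cubature_vec_def)
    qed
    have "cubature_nodes n S x $$ (i,j) = (S *\<^sub>v ?u + x) $ i"
      using ij by (simp add: cubature_nodes_def mat_of_cols_index)
    moreover have "(S *\<^sub>v ?u + x) $ i = (S *\<^sub>v ?u) $ i + x $ i"
      using ij x by (intro index_add_vec) auto
    ultimately have "?X $$ (i,j) = 1 / sqrt (2 * real n) * (S *\<^sub>v ?u) $ i"
      using ij x by (simp add: scaled_dev_def kron_def mat_of_cols_index del: index_mult_mat_vec)
    also have "\<dots> = ?H $$ (i,j)"
      using ij S n unfolding Su by (auto simp: hcat_def real_sqrt_mult)
    finally show "?X $$ (i,j) = ?H $$ (i,j)" .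
  qed
  have "?X * transpose_mat ?X = ((1/2) \<cdot>\<^sub>m (S * transpose_mat S)) + ((1/2) \<cdot>\<^sub>m (S * transpose_mat S))"
    unfolding split using S
    by (subst hcat_gram[of _ n n _ n])
      (auto intro!: eq_matI)
  also have "\<dots> = S * transpose_mat S"
    using S by (intro eq_matI) auto
  finally show ?thesis .
qed

section \<open>One step of the SVD-based filter in terms of covariances\<close>

lemma node_mean_carrier: "dim_row X = p \<Longrightarrow> node_mean n X \<in> carrier_vec p"
  unfolding node_mean_def by (rule carrier_vecI) simp

text \<open>The second block of the time-update pre-array is a square root of the discretized process noise
  covariance.\<close>

lemma process_noise_gram:
  assumes "is_psd_svd W Q D" "W \<in> carrier_mat n n" "G \<in> carrier_mat n n" "0 \<le> c"
  shows "(sqrt c \<cdot>\<^sub>m (G * Q * diag_sqrt D)) * transpose_mat (sqrt c \<cdot>\<^sub>m (G * Q * diag_sqrt D))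
    = c \<cdot>\<^sub>m (G * W * transpose_mat G)"
proof -
  have Q: "Q \<in> carrier_mat n n" and D: "diag_sqrt D \<in> carrier_mat n n"
    using is_psd_svd_carrier[OF assms(1,2)] .
  define F where "F = Q * diag_sqrt D"
  have F: "F \<in> carrier_mat n n" using Q D by (simp add: F_def)
  have FF: "F * transpose_mat F = W"
    unfolding F_def by (rule is_psd_svd_root_gram[OF assms(1)])
  have GQ: "G * Q * diag_sqrt D = G * F"
    using assms(3) Q D by (simp add: F_def)
  have "(G * F) * transpose_mat (G * F) = (G * F) * (transpose_mat F * transpose_mat G)"
    using assms(3) F by (simp add: transpose_mult[of _ n n _ n])
  also have "\<dots> = G * (F * transpose_mat F) * transpose_mat G"
    using assms(3) F by (simp add: assoc_mult_mat[of _ n n _ n _ n])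
  finally have GF: "(G * F) * transpose_mat (G * F) = G * W * transpose_mat G"
    by (simp only: FF)
  define U where "U = G * F"
  have U: "U \<in> carrier_mat n n" using assms(3) F by (simp add: U_def)
  have "transpose_mat (sqrt c \<cdot>\<^sub>m U) = sqrt c \<cdot>\<^sub>m transpose_mat U"
    by (intro eq_matI) auto
  then have "(sqrt c \<cdot>\<^sub>m U) * transpose_mat (sqrt c \<cdot>\<^sub>m U)
    = sqrt c \<cdot>\<^sub>m (sqrt c \<cdot>\<^sub>m (U * transpose_mat U))"
    using U by (simp add: mult_smult_distrib[of _ n n _ n] mult_smult_assoc_mat[of _ n n _ n])
  also have "\<dots> = c \<cdot>\<^sub>m (U * transpose_mat U)"
    using assms(4) by (intro eq_matI) (simp_all add: mult.assoc[symmetric])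
  finally show ?thesis by (simp only: GQ GF U_def)
qed

text \<open>The Gram matrix of the pre-array splits into the spread of the propagated points and the process
  noise; the last conclusion is therefore the covariance recursion of the conventional filter.\<close>

lemma svd_time_update_step:
  assumes valid: "valid_ckf_data d" and proc: "is_psd_svd (proc_cov d) (Q_proc b) (D_proc b)"
    and upd: "svd_time_update d b k" and m: "m < substeps d"
  defines "Y \<equiv> propagated_nodes d k m (cubature_nodes (dim_x d) (Q_sub b k m * Dh_sub b k m) (x_sub b k m))"
  defines "X \<equiv> scaled_dev (dim_x d) Y (x_sub b k (Suc m))"
  shows "x_sub b k (Suc m) = node_mean (dim_x d) Y"
    and "x_sub b k (Suc m) \<in> carrier_vec (dim_x d)"
    and "sqrt_factors (dim_x d) (Q_sub b k (Suc m)) (Dh_sub b k (Suc m))"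
    and "X * transpose_mat X + substep d \<cdot>\<^sub>m (diffusion d * proc_cov d * transpose_mat (diffusion d))
      = cov_of_factors (Q_sub b k (Suc m)) (Dh_sub b k (Suc m))"
proof -
  let ?n = "dim_x d"
  let ?N = "sqrt (substep d) \<cdot>\<^sub>m (diffusion d * Q_proc b * diag_sqrt (D_proc b))"
  show mean: "x_sub b k (Suc m) = node_mean ?n Y"
    using upd m unfolding svd_time_update_def Let_def Y_def by blast
  show x: "x_sub b k (Suc m) \<in> carrier_vec ?n"
    unfolding mean by (rule node_mean_carrier) (simp add: Y_def propagated_nodes_def)
  have svd: "svd_econ (hcat X ?N) (Q_sub b k (Suc m)) (Dh_sub b k (Suc m))"
    using upd m unfolding svd_time_update_def Let_def Y_def X_def by blast
  have X: "X \<in> carrier_mat ?n (2 * ?n)" unfolding X_def by (rule scaled_dev_carrier[OF x])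
  have G: "diffusion d \<in> carrier_mat ?n ?n" and W: "proc_cov d \<in> carrier_mat ?n ?n"
    and \<delta>: "0 \<le> substep d"
    using valid by (auto simp: valid_ckf_data_def Let_def pos_def_mat_def substep_def)
  have N: "?N \<in> carrier_mat ?n ?n"
    using is_psd_svd_carrier[OF proc W] G by simp
  show "sqrt_factors ?n (Q_sub b k (Suc m)) (Dh_sub b k (Suc m))"
    using svd_econ_sqrt_factors[OF svd] hcat_carrier[OF X N] by simp
  show "X * transpose_mat X + substep d \<cdot>\<^sub>m (diffusion d * proc_cov d * transpose_mat (diffusion d))
      = cov_of_factors (Q_sub b k (Suc m)) (Dh_sub b k (Suc m))"
    using svd_econ_gram[OF svd] hcat_gram[OF X N] process_noise_gram[OF proc W G \<delta>] by simp
qed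

text \<open>Since there is at least one substep, the predicted factors come out of an economy-size SVD and
  are well formed whatever the filter started the period with.\<close>

lemma svd_time_update_pred:
  assumes "valid_ckf_data d" "is_psd_svd (proc_cov d) (Q_proc b) (D_proc b)" "svd_time_update d b k"
  shows "sqrt_factors (dim_x d) (Q_pred b k) (Dh_pred b k)" "x_pred b k \<in> carrier_vec (dim_x d)"
proof -
  have "1 \<le> substeps d" using assms(1) by (simp add: valid_ckf_data_def Let_def)
  then obtain m where m: "substeps d = Suc m" by (cases "substeps d") auto
  have "Q_pred b k = Q_sub b k (Suc m)" "Dh_pred b k = Dh_sub b k (Suc m)" "x_pred b k = x_sub b k (Suc m)"
    using assms(3) m by (auto simp: svd_time_update_def)
  then show "sqrt_factors (dim_x d) (Q_pred b k) (Dh_pred b k)" "x_pred b k \<in> carrier_vec (dim_x d)"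
    using svd_time_update_step[OF assms, of m] m by simp_all
qed

text \<open>The innovation covariance is read off its pre-array by \<open>hcat_gram\<close>; positive definiteness of
  the noise covariance makes it invertible, so the factored gain is the conventional one; and the
  filtered covariance is the Joseph form. The conclusions thus contain all equations of the
  conventional measurement update.\<close>

lemma svd_meas_update_eqs:
  assumes valid: "valid_ckf_data d" and k: "k \<in> {1..horizon d}"
    and meas: "is_psd_svd (meas_cov d k) (Q_meas b k) (D_meas b k)"
    and upd: "svd_meas_update d b k"
    and pred: "sqrt_factors (dim_x d) (Q_pred b k) (Dh_pred b k)" and x: "x_pred b k \<in> carrier_vec (dim_x d)"
  defines "Y \<equiv> cubature_nodes (dim_x d) (Q_pred b k * Dh_pred b k) (x_pred b k)"
  defines "H \<equiv> observed_nodes d k Y"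
  defines "X \<equiv> scaled_dev (dim_x d) Y (x_pred b k)"
  defines "Z \<equiv> scaled_dev (dim_x d) H (z_pred b k)"
  shows "z_pred b k = node_mean (dim_x d) H"
    and "cross_cov b k = X * transpose_mat Z"
    and "x_filt b k = x_pred b k + gain b k *\<^sub>v (meas d k - z_pred b k)"
    and "x_filt b k \<in> carrier_vec (dim_x d)"
    and "sqrt_factors (dim_z d) (Q_innov b k) (Dh_innov b k)"
    and "sqrt_factors (dim_x d) (Q_filt b k) (Dh_filt b k)"
    and "Z * transpose_mat Z + meas_cov d k = cov_of_factors (Q_innov b k) (Dh_innov b k)"
    and "invertible_mat (cov_of_factors (Q_innov b k) (Dh_innov b k))"
    and "gain b k = cross_cov b k * mat_inv (cov_of_factors (Q_innov b k) (Dh_innov b k))"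
    and "cov_of_factors (Q_filt b k) (Dh_filt b k) = cov_of_factors (Q_pred b k) (Dh_pred b k)
      - gain b k * cov_of_factors (Q_innov b k) (Dh_innov b k) * transpose_mat (gain b k)"
proof -
  let ?n = "dim_x d" and ?p = "dim_z d" and ?K = "gain b k"
  let ?G = "Q_meas b k * diag_sqrt (D_meas b k)"
  let ?Re = "cov_of_factors (Q_innov b k) (Dh_innov b k)"
  have n: "0 < ?n" and R: "pos_def_mat ?p (meas_cov d k)"
    using valid k by (auto simp: valid_ckf_data_def Let_def)
  have Rc: "meas_cov d k \<in> carrier_mat ?p ?p" using R by (simp add: pos_def_mat_def)
  show z: "z_pred b k = node_mean ?n H"
    using upd unfolding svd_meas_update_def Let_def Y_def H_def by blast
  show cross: "cross_cov b k = X * transpose_mat Z"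
    using upd unfolding svd_meas_update_def Let_def Y_def H_def X_def Z_def by blast
  show xf: "x_filt b k = x_pred b k + ?K *\<^sub>v (meas d k - z_pred b k)"
    using upd unfolding svd_meas_update_def Let_def by blast
  have innov: "svd_econ (hcat Z ?G) (Q_innov b k) (Dh_innov b k)"
    using upd unfolding svd_meas_update_def Let_def Y_def H_def Z_def by blast
  have gain: "?K = cross_cov b k * Q_innov b k * mat_inv (diag_sq (Dh_innov b k)) * transpose_mat (Q_innov b k)"
    using upd unfolding svd_meas_update_def Let_def by blast
  have filt: "svd_econ (hcat (X - ?K * Z) (?K * ?G)) (Q_filt b k) (Dh_filt b k)"
    using upd unfolding svd_meas_update_def Let_def Y_def H_def X_def Z_def by blast
  have zc: "z_pred b k \<in> carrier_vec ?p"
    unfolding z by (rule node_mean_carrier) (simp add: H_def observed_nodes_def)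
  have X: "X \<in> carrier_mat ?n (2 * ?n)" unfolding X_def by (rule scaled_dev_carrier[OF x])
  have Z: "Z \<in> carrier_mat ?p (2 * ?n)" unfolding Z_def by (rule scaled_dev_carrier[OF zc])
  have G: "?G \<in> carrier_mat ?p ?p"
    using is_psd_svd_carrier[OF meas Rc] by simp
  have GG: "?G * transpose_mat ?G = meas_cov d k" by (rule is_psd_svd_root_gram[OF meas])
  show fi: "sqrt_factors ?p (Q_innov b k) (Dh_innov b k)"
    using svd_econ_sqrt_factors[OF innov] hcat_carrier[OF Z G] by simp
  show Re: "Z * transpose_mat Z + meas_cov d k = ?Re"
    using svd_econ_gram[OF innov] hcat_gram[OF Z G] GG by simp
  obtain B where B: "B \<in> carrier_mat ?p ?p" "?Re * B = 1\<^sub>m ?p" "B * ?Re = 1\<^sub>m ?p"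
    using gram_plus_pos_def_inverse[OF Z R] unfolding Re by blast
  have Rec: "?Re \<in> carrier_mat ?p ?p" using Z Rc by (simp add: Re[symmetric])
  show "invertible_mat ?Re" by (rule invertible_matI[OF Rec B])
  have Q: "orthonormal_mat ?p (Q_innov b k)" and E: "nonneg_diag_mat ?p (Dh_innov b k)"
    using fi by (auto simp: sqrt_factors_def)
  have inv: "mat_inv ?Re = B" by (rule mat_inv_eqI[OF Rec B])
  \<comment> \<open>the gain of the SVD-based filter contains the inverse innovation covariance in factored form\<close>
  have QDQ: "Q_innov b k * mat_inv (diag_sq (Dh_innov b k)) * transpose_mat (Q_innov b k) = mat_inv ?Re"
    by (rule mat_inv_orthonormal_conj[OF Q diag_sq_carrier[OF E] cov_of_factors_def B])
  have Dinv: "mat_inv (diag_sq (Dh_innov b k)) \<in> carrier_mat ?p ?p"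
    by (rule mat_inv_orthonormal_conj_carrier[OF Q diag_sq_carrier[OF E] cov_of_factors_def B])
  have C: "cross_cov b k \<in> carrier_mat ?n ?p" using X Z by (simp add: cross)
  have "?K = cross_cov b k * (Q_innov b k * mat_inv (diag_sq (Dh_innov b k)) * transpose_mat (Q_innov b k))"
    unfolding gain using C orthonormal_matD(1)[OF Q] Dinv
    by (simp add: assoc_mult_mat[of _ ?n ?p _ ?p _ ?p] assoc_mult_mat[of _ ?p ?p _ ?p _ ?p])
  then show K: "?K = cross_cov b k * mat_inv ?Re" by (simp only: QDQ)
  have Kc: "?K \<in> carrier_mat ?n ?p" using C B by (simp add: K inv)
  show "x_filt b k \<in> carrier_vec ?n" unfolding xf using Kc by (intro carrier_vecI) simp
  \<comment> \<open>the only property of the gain that the Joseph form uses\<close>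
  have KRe: "?K * ?Re = X * transpose_mat Z"
    using C B Rec by (simp add: K inv assoc_mult_mat[of _ ?n ?p _ ?p _ ?p]) (simp add: cross)
  have XKZ: "X - ?K * Z \<in> carrier_mat ?n (2 * ?n)" and KG: "?K * ?G \<in> carrier_mat ?n ?p"
    using Kc Z G by (auto intro!: minus_carrier_mat mult_carrier_mat)
  show "sqrt_factors ?n (Q_filt b k) (Dh_filt b k)"
    using svd_econ_sqrt_factors[OF filt] hcat_carrier[OF XKZ KG] by simp
  have Qp: "Q_pred b k \<in> carrier_mat ?n ?n" and Ep: "nonneg_diag_mat ?n (Dh_pred b k)"
    using pred by (auto simp: sqrt_factors_def orthonormal_mat_def)
  have "X * transpose_mat X = cov_of_factors (Q_pred b k) (Dh_pred b k)"
    unfolding X_def Y_def cov_of_factors_def factor_gram[OF Qp Ep, symmetric]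
    using Qp Ep by (intro cubature_dev_gram[OF n _ x]) (auto simp: nonneg_diag_mat_def)
  moreover have "cov_of_factors (Q_filt b k) (Dh_filt b k)
      = (X - ?K * Z) * transpose_mat (X - ?K * Z) + (?K * ?G) * transpose_mat (?K * ?G)"
    using svd_econ_gram[OF filt] hcat_gram[OF XKZ KG] by simp
  moreover have "\<dots> = X * transpose_mat X - ?K * ?Re * transpose_mat ?K"
    using joseph_form[OF X Z Kc G, unfolded GG Re, OF KRe] .
  ultimately show "cov_of_factors (Q_filt b k) (Dh_filt b k) = cov_of_factors (Q_pred b k) (Dh_pred b k)
      - ?K * ?Re * transpose_mat ?K" by simp
qed

lemma svd_ckf_runD:
  assumes "svd_ckf_run d b"
  shows "is_psd_svd (proc_cov d) (Q_proc b) (D_proc b)"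
    and "is_psd_svd (init_cov d) (Q_init b) (D_init b)"
    and "x_filt b 0 = init_mean d" and "Q_filt b 0 = Q_init b" and "Dh_filt b 0 = diag_sqrt (D_init b)"
    and "k \<in> {1..horizon d} \<Longrightarrow> is_psd_svd (meas_cov d k) (Q_meas b k) (D_meas b k)"
    and "k \<in> {1..horizon d} \<Longrightarrow> svd_time_update d b k"
    and "k \<in> {1..horizon d} \<Longrightarrow> svd_meas_update d b k"
  using assms by (simp_all add: svd_ckf_run_def)

section \<open>Factors along a whole run\<close>

lemma svd_run_step:
  assumes valid: "valid_ckf_data d" and run: "svd_ckf_run d b" and k: "k \<in> {1..horizon d}"
  shows "sqrt_factors (dim_z d) (Q_innov b k) (Dh_innov b k)"
    and "sqrt_factors (dim_x d) (Q_filt b k) (Dh_filt b k)"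
proof -
  note pred = svd_time_update_pred[OF valid svd_ckf_runD(1)[OF run] svd_ckf_runD(7)[OF run k]]
  show "sqrt_factors (dim_z d) (Q_innov b k) (Dh_innov b k)"
    "sqrt_factors (dim_x d) (Q_filt b k) (Dh_filt b k)"
    using svd_meas_update_eqs(5,6)[OF valid k svd_ckf_runD(6,8)[OF run k] pred] .
qed

lemma svd_run_filt:
  assumes valid: "valid_ckf_data d" and run: "svd_ckf_run d b" and k: "k \<le> horizon d"
  shows "sqrt_factors (dim_x d) (Q_filt b k) (Dh_filt b k)"
proof (cases k)
  case 0
  have "dim_row (init_cov d) = dim_x d"
    using valid by (auto simp: valid_ckf_data_def Let_def pos_def_mat_def)
  then show ?thesis
    using is_psd_svd_sqrt_factors(1)[OF svd_ckf_runD(2)[OF run]] svd_ckf_runD(4,5)[OF run]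
    by (simp only: 0)
next
  case (Suc j)
  then show ?thesis using svd_run_step(2)[OF valid run] k by simp
qed

lemma svd_run_sub:
  assumes valid: "valid_ckf_data d" and run: "svd_ckf_run d b"
    and k: "k \<in> {1..horizon d}" and m: "m \<le> substeps d"
  shows "sqrt_factors (dim_x d) (Q_sub b k m) (Dh_sub b k m)"
proof (cases m)
  case 0
  have "Q_sub b k 0 = Q_filt b (k - 1)" "Dh_sub b k 0 = Dh_filt b (k - 1)"
    using svd_ckf_runD(7)[OF run k] unfolding svd_time_update_def by blast+
  moreover have "k - 1 \<le> horizon d" using k by auto
  ultimately show ?thesis
    using svd_run_filt[OF valid run, of "k - 1"] by (simp add: 0)
next
  case (Suc j)
  then show ?thesis
    using svd_time_update_step(3)[OF valid svd_ckf_runD(1)[OF run] svd_ckf_runD(7)[OF run k]] m by simp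
qed

section \<open>The run of the conventional filter induced by a run of the SVD-based filter\<close>

definition conv_of_svd :: "svd_run \<Rightarrow> conv_run" where
  "conv_of_svd b =
    \<lparr> x_sub = x_sub b, x_pred = x_pred b, z_pred = z_pred b, x_filt = x_filt b,
      cross_cov = cross_cov b, gain = gain b,
      cov_sub = (\<lambda>k m. cov_of_factors (Q_sub b k m) (Dh_sub b k m)),
      cov_pred = (\<lambda>k. cov_of_factors (Q_pred b k) (Dh_pred b k)),
      cov_innov = (\<lambda>k. cov_of_factors (Q_innov b k) (Dh_innov b k)),
      cov_filt = (\<lambda>k. cov_of_factors (Q_filt b k) (Dh_filt b k)),
      svdQ_sub = Q_sub b, svdD_sub = (\<lambda>k m. diag_sq (Dh_sub b k m)),
      svdQ_pred = Q_pred b, svdD_pred = (\<lambda>k. diag_sq (Dh_pred b k)) \<rparr>"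

lemma same_svd_choices_conv_of_svd: "same_svd_choices d (conv_of_svd b) b"
  by (simp add: same_svd_choices_def conv_of_svd_def)

lemma sqrt_factors_diag_sqrt: "sqrt_factors n Q Dh \<Longrightarrow> diag_sqrt (diag_sq Dh) = Dh"
  unfolding sqrt_factors_def by (blast intro: diag_sqrt_diag_sq)

lemma conv_ckf_run_conv_of_svd:
  assumes valid: "valid_ckf_data d" and run: "svd_ckf_run d b"
  shows "conv_ckf_run d (conv_of_svd b)"
  unfolding conv_ckf_run_def
proof (intro conjI ballI)
  note proc = svd_ckf_runD(1)[OF run] and init = svd_ckf_runD(2)[OF run]
  show "x_filt (conv_of_svd b) 0 = init_mean d" "cov_filt (conv_of_svd b) 0 = init_cov d"
    using svd_ckf_runD(3-5)[OF run] is_psd_svd_sqrt_factors(2)[OF init refl]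
    by (simp_all add: conv_of_svd_def)
  fix k assume k: "k \<in> {1..horizon d}"
  note meas = svd_ckf_runD(6)[OF run k] and t = svd_ckf_runD(7)[OF run k]
    and u = svd_ckf_runD(8)[OF run k]
  note pred = svd_time_update_pred[OF valid proc t]
  have sub: "sqrt_factors (dim_x d) (Q_sub b k m) (Dh_sub b k m)" if "m < substeps d" for m
    using svd_run_sub[OF valid run k] that by simp
  show "conv_time_update d (conv_of_svd b) k"
    unfolding conv_time_update_def
  proof (intro conjI allI impI)
    fix m assume m: "m < substeps d"
    show "is_psd_svd (cov_sub (conv_of_svd b) k m) (svdQ_sub (conv_of_svd b) k m) (svdD_sub (conv_of_svd b) k m)"
      using is_psd_svd_cov_of_factors[OF sub[OF m]] by (simp add: conv_of_svd_def)
    show "let n = dim_x d;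
             S = svdQ_sub (conv_of_svd b) k m * diag_sqrt (svdD_sub (conv_of_svd b) k m);
             Y = propagated_nodes d k m (cubature_nodes n S (x_sub (conv_of_svd b) k m));
             X = scaled_dev n Y (x_sub (conv_of_svd b) k (Suc m))
         in x_sub (conv_of_svd b) k (Suc m) = node_mean n Y \<and>
            cov_sub (conv_of_svd b) k (Suc m) =
              X * transpose_mat X +
              substep d \<cdot>\<^sub>m (diffusion d * proc_cov d * transpose_mat (diffusion d))"
      using svd_time_update_step(1,4)[OF valid proc t m]
      by (simp add: Let_def conv_of_svd_def sqrt_factors_diag_sqrt[OF sub[OF m]])
  qed (use t in \<open>simp_all add: conv_of_svd_def svd_time_update_def\<close>)
  note e = svd_meas_update_eqs[OF valid k meas u pred]
  show "conv_meas_update d (conv_of_svd b) k"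
    using is_psd_svd_cov_of_factors[OF pred(1)] e(1-3,7-10)
    by (simp add: conv_meas_update_def conv_of_svd_def Let_def sqrt_factors_diag_sqrt[OF pred(1)])
qed

section \<open>Any conventional run with the same factors agrees with the SVD-based run\<close>

text \<open>A time update of the conventional filter sees the covariance only through the square root formed
  from the chosen factors, so equal choices and equal initial estimates give equal estimates.\<close>

lemma time_update_agree:
  assumes valid: "valid_ckf_data d" and run: "svd_ckf_run d b"
    and a: "conv_ckf_run d a" and same: "same_svd_choices d a b" and k: "k \<in> {1..horizon d}"
    and x: "x_filt a (k - 1) = x_filt b (k - 1)"
  shows "m \<le> substeps d \<Longrightarrow> x_sub a k m = x_sub b k m"
proof (induction m)
  have t: "conv_time_update d a k" and s: "svd_time_update d b k"
    using a k svd_ckf_runD(7)[OF run k] unfolding conv_ckf_run_def by blast+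
  {
    case 0
    show ?case using t s x by (simp add: conv_time_update_def svd_time_update_def)
  next
    case (Suc m)
    have "svdQ_sub a k m * diag_sqrt (svdD_sub a k m) = Q_sub b k m * Dh_sub b k m"
      using same k Suc.prems sqrt_factors_diag_sqrt[OF svd_run_sub[OF valid run k, of m]]
      by (simp add: same_svd_choices_def)
    then show ?case using t s Suc by (simp add: conv_time_update_def svd_time_update_def Let_def)
  }
qed

text \<open>A legitimate choice of factors determines the matrix being factorized, so the common choice
  forces the predicted covariance of the conventional run to be the one carried by the SVD-based
  run. The remaining quantities are then given by the equations that \<open>svd_meas_update_eqs\<close>
  establishes for the SVD-based run.\<close>

lemma meas_update_agree:
  assumes valid: "valid_ckf_data d" and run: "svd_ckf_run d b"
    and a: "conv_ckf_run d a" and same: "same_svd_choices d a b" and k: "k \<in> {1..horizon d}"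
    and x: "x_pred a k = x_pred b k"
  shows "z_pred a k = z_pred b k" "cross_cov a k = cross_cov b k" "gain a k = gain b k"
    "x_filt a k = x_filt b k"
    "cov_innov a k = cov_of_factors (Q_innov b k) (Dh_innov b k)"
    "cov_filt a k = cov_of_factors (Q_filt b k) (Dh_filt b k)"
proof -
  note pred = svd_time_update_pred[OF valid svd_ckf_runD(1)[OF run] svd_ckf_runD(7)[OF run k]]
  note e = svd_meas_update_eqs[OF valid k svd_ckf_runD(6,8)[OF run k] pred]
  have au: "conv_meas_update d a k" using a k unfolding conv_ckf_run_def by blast
  have ch: "svdQ_pred a k = Q_pred b k" "svdD_pred a k = diag_sq (Dh_pred b k)"
    using same k by (auto simp: same_svd_choices_def)
  \<comment> \<open>the chosen factors multiply back to the covariance, in either run\<close>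
  have P: "cov_pred a k = cov_of_factors (Q_pred b k) (Dh_pred b k)"
    using au unfolding conv_meas_update_def is_psd_svd_def spectral_factors_def cov_of_factors_def ch
    by blast
  note au' = au[unfolded conv_meas_update_def Let_def ch sqrt_factors_diag_sqrt[OF pred(1)] x]
  show z: "z_pred a k = z_pred b k" using au' e(1) by simp
  show C: "cross_cov a k = cross_cov b k" using au' e(2) by (simp add: z)
  show R: "cov_innov a k = cov_of_factors (Q_innov b k) (Dh_innov b k)" using au' e(7) by (simp add: z)
  show K: "gain a k = gain b k" using au' e(9) by (simp add: C R)
  show "x_filt a k = x_filt b k" using au' e(3) by (simp add: K z)
  show "cov_filt a k = cov_of_factors (Q_filt b k) (Dh_filt b k)"
    using au' e(10) by (simp add: K R P)
qed

lemma x_filt_agree: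
  assumes valid: "valid_ckf_data d" and run: "svd_ckf_run d b"
    and a: "conv_ckf_run d a" and same: "same_svd_choices d a b"
  shows "k \<le> horizon d \<Longrightarrow> x_filt a k = x_filt b k"
proof (induction k)
  case 0
  show ?case using a run by (simp add: conv_ckf_run_def svd_ckf_run_def)
next
  case (Suc k)
  then have k: "Suc k \<in> {1..horizon d}" by simp
  have "x_sub a (Suc k) (substeps d) = x_sub b (Suc k) (substeps d)"
    using time_update_agree[OF valid run a same k] Suc by simp
  then have "x_pred a (Suc k) = x_pred b (Suc k)"
    using a k svd_ckf_runD(7)[OF run k]
    unfolding conv_ckf_run_def conv_time_update_def svd_time_update_def by metis
  then show ?case by (rule meas_update_agree(4)[OF valid run a same k])
qed

theorem proposition2:
  fixes d :: ckf_data and b :: svd_run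
  assumes "valid_ckf_data d" and "svd_ckf_run d b"
  shows "(\<exists>a. conv_ckf_run d a \<and> same_svd_choices d a b) \<and>
    (\<forall>a. conv_ckf_run d a \<and> same_svd_choices d a b \<longrightarrow>
      (\<forall>k\<in>{1..horizon d}.
        (\<forall>m\<in>{0..substeps d}. x_sub a k m = x_sub b k m) \<and>
        x_pred a k = x_pred b k \<and>
        z_pred a k = z_pred b k \<and>
        x_filt a k = x_filt b k \<and>
        cross_cov a k = cross_cov b k \<and>
        gain a k = gain b k \<and>
        (\<forall>m\<in>{0..substeps d}.
           spectral_factors (cov_sub a k m) (Q_sub b k m) (diag_sq (Dh_sub b k m))) \<and>
        spectral_factors (cov_pred a k) (Q_pred b k) (diag_sq (Dh_pred b k)) \<and>
        spectral_factors (cov_innov a k) (Q_innov b k) (diag_sq (Dh_innov b k)) \<and>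
        spectral_factors (cov_filt a k) (Q_filt b k) (diag_sq (Dh_filt b k))))"
proof (intro conjI allI impI ballI)
  note valid = assms(1) and run = assms(2)
  show "\<exists>a. conv_ckf_run d a \<and> same_svd_choices d a b"
    using conv_ckf_run_conv_of_svd[OF assms] same_svd_choices_conv_of_svd by blast
  fix a k assume "conv_ckf_run d a \<and> same_svd_choices d a b" and k: "k \<in> {1..horizon d}"
  then have a: "conv_ckf_run d a" and same: "same_svd_choices d a b" by auto
  have t: "conv_time_update d a k" and s: "svd_time_update d b k" and u: "conv_meas_update d a k"
    using a k svd_ckf_runD(7)[OF run k] unfolding conv_ckf_run_def by blast+
  have "k - 1 \<le> horizon d" using k by auto
  note xs = time_update_agree[OF valid run a same k x_filt_agree[OF valid run a same this]]
  then show "x_sub a k m = x_sub b k m" if "m \<in> {0..substeps d}" for m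
    using that by simp
  show x: "x_pred a k = x_pred b k"
    using t s xs[of "substeps d"] by (simp add: conv_time_update_def svd_time_update_def)
  note e = meas_update_agree[OF valid run a same k x]
  show "z_pred a k = z_pred b k" "x_filt a k = x_filt b k" "cross_cov a k = cross_cov b k"
    "gain a k = gain b k" using e by simp_all
  show P: "spectral_factors (cov_pred a k) (Q_pred b k) (diag_sq (Dh_pred b k))"
    using u same k by (simp add: conv_meas_update_def same_svd_choices_def is_psd_svd_def)
  show "spectral_factors (cov_sub a k m) (Q_sub b k m) (diag_sq (Dh_sub b k m))"
    if m: "m \<in> {0..substeps d}" for m
  \<comment> \<open>after the last substep the covariance is next decomposed as the predicted covariance, in the measurement update\<close>
  proof (cases "m = substeps d")
    case True
    then show ?thesis using P t s by (simp add: conv_time_update_def svd_time_update_def)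
  next
    case False
    then have "m < substeps d" using m by simp
    then show ?thesis
      using t same k by (simp add: conv_time_update_def same_svd_choices_def is_psd_svd_def)
  qed
  show "spectral_factors (cov_innov a k) (Q_innov b k) (diag_sq (Dh_innov b k))"
    unfolding e(5) using is_psd_svd_cov_of_factors[OF svd_run_step(1)[OF valid run k]] is_psd_svd_def by blast
  show "spectral_factors (cov_filt a k) (Q_filt b k) (diag_sq (Dh_filt b k))"
    unfolding e(6) using is_psd_svd_cov_of_factors[OF svd_run_step(2)[OF valid run k]] is_psd_svd_def by blast
qed

end
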